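(* Let $(\rho_0,V_0)$ be a smooth representation of $\mathfrak K(\sigma_0)$ and $(\rho_1,V_1)$ a smooth representation of $\mathfrak K(\sigma_1)$. Suppose that there exists an $F^\times I$-equivariant isomorphism $r:V_1\cong V_0$. Then there exists a unique (up to isomorphism) smooth representation $\pi$ of $G$ such that $$\pi|_{\mathfrak K(\sigma_0)}\cong\rho_0,\qquad\pi|_{\mathfrak K(\sigma_1)}\cong\rho_1$$ via isomorphisms $\iota_0:V_0\to\pi$ and $\iota_1:V_1\to\pi$ (equivariant for $\mathfrak K(\sigma_0)$ and $\mathfrak K(\sigma_1)$ respectively) for which the diagram of $F^\times I$-representations commutes, i.e. $\iota_0\circ r=\iota_1$.
   Context: $F$ is a non-Archimedean local field with residue characteristic $p$, ring of integers $\mathfrak o_F$, maximal ideal $\mathfrak p_F$, uniformiser $\varpi_F$. $G=\mathrm{GL}_2(F)$, $K=\mathrm{GL}_2(\mathfrak o_F)$, $I\subset K$ is the Iwahori subgroup of matrices upper triangular modulo $\mathfrak p_F$. $\mathfrak K(\sigma_0)=F^\times K$ (stabiliser of a vertex $\sigma_0$ of the Bruhat–Tits tree) and $\mathfrak K(\sigma_1)$ is the subgroup generated by $I$ and $\Pi=\begin{pmatrix}0&1\\ \varpi_F&0\end{pmatrix}$ (stabiliser of an edge $\sigma_1$ containing $\sigma_0$); $\mathfrak K(\sigma_0)\cap\mathfrak K(\sigma_1)=F^\times I$. All representations are on $\overline{\mathbf F}_p$-vector spaces. *)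

theory Defs
  imports
    "HOL-Analysis.Analysis"
    "HOL-Algebra.Generated_Groups"
    "HOL-Algebra.Algebraic_Closure_Type"
    "Berlekamp_Zassenhaus.Finite_Field"
begin

section \<open>Non-Archimedean local fields\<close>

definition ring_of_integers :: "('f::field \<Rightarrow> real) \<Rightarrow> 'f set" where
  "ring_of_integers av = {x. av x \<le> 1}"

definition max_ideal :: "('f::field \<Rightarrow> real) \<Rightarrow> 'f set" where
  "max_ideal av = {x. av x < 1}"

definition uniformiser :: "('f::field \<Rightarrow> real) \<Rightarrow> 'f \<Rightarrow> bool" where
  "uniformiser av w \<longleftrightarrow> w \<noteq> 0 \<and> max_ideal av = (\<lambda>x. w * x) ` ring_of_integers av"

definition residue_field :: "('f::field \<Rightarrow> real) \<Rightarrow> 'f set set" where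
  "residue_field av = ring_of_integers av //
     {(x, y). x \<in> ring_of_integers av \<and> y \<in> ring_of_integers av \<and> x - y \<in> max_ideal av}"

text \<open>The library's definition of \<open>CHAR\<close>, read in the residue field: \<open>of_nat n\<close> has
  trivial class there iff it lies in the maximal ideal.\<close>

definition residue_char :: "('f::field \<Rightarrow> real) \<Rightarrow> nat" where
  "residue_char av = Gcd {n. (of_nat n :: 'f) \<in> max_ideal av}"

text \<open>Completeness is the class \<open>complete_space\<close>, for the metric of the absolute value.
  The existence of a uniformiser says that the absolute value is nontrivial and discrete.\<close>

locale nonarch_local_field =
  fixes av :: "'f::{field, complete_space} \<Rightarrow> real"
  assumes av_nonneg: "0 \<le> av x"
    and av_eq_0_iff: "av x = 0 \<longleftrightarrow> x = 0"
    and av_mult: "av (x * y) = av x * av y"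
    and av_ultrametric: "av (x + y) \<le> max (av x) (av y)"
    and dist_av: "dist x y = av (x - y)"
    and ex_uniformiser: "\<exists>w. uniformiser av w"
    and finite_residue_field: "finite (residue_field av)"


section \<open>\<open>GL\<^sub>2(F)\<close> and its subgroups\<close>

definition GL2 :: "('f::field ^ 2 ^ 2) monoid" where
  "GL2 = \<lparr>carrier = {g. invertible g}, monoid.mult = (**), one = mat 1\<rparr>"

definition GL2_integers :: "('f::field \<Rightarrow> real) \<Rightarrow> ('f ^ 2 ^ 2) set" where
  "GL2_integers av = {g. (\<forall>i j. g $ i $ j \<in> ring_of_integers av) \<and>
     (\<exists>h. (\<forall>i j. h $ i $ j \<in> ring_of_integers av) \<and> g ** h = mat 1 \<and> h ** g = mat 1)}"

definition Iwahori :: "('f::field \<Rightarrow> real) \<Rightarrow> ('f ^ 2 ^ 2) set" where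
  "Iwahori av = {g \<in> GL2_integers av. g $ 2 $ 1 \<in> max_ideal av}"

definition scalar_multiples :: "('f::field ^ 2 ^ 2) set \<Rightarrow> ('f ^ 2 ^ 2) set" where
  "scalar_multiples H = {mat c ** h | c h. c \<noteq> 0 \<and> h \<in> H}"

definition vertex_stabiliser :: "('f::field \<Rightarrow> real) \<Rightarrow> ('f ^ 2 ^ 2) set" where
  "vertex_stabiliser av = scalar_multiples (GL2_integers av)"

definition Pi_matrix :: "'f::field \<Rightarrow> 'f ^ 2 ^ 2" where
  "Pi_matrix w = vector [vector [0, 1], vector [w, 0]]"

definition edge_stabiliser :: "('f::field \<Rightarrow> real) \<Rightarrow> 'f \<Rightarrow> ('f ^ 2 ^ 2) set" where
  "edge_stabiliser av w = generate GL2 (insert (Pi_matrix w) (Iwahori av))"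


section \<open>Smooth representations\<close>

text \<open>A representation of \<open>H\<close> is a function on all matrices of which only the values on \<open>H\<close>
  matter. The group \<open>H\<close> carries the subspace topology from the space of all 2 by 2 matrices;
  inversion is continuous for it, so for \<open>GL\<^sub>2(F)\<close> this is the usual topology.\<close>

locale smooth_representation = vector_space smul
  for smul :: "'k::field \<Rightarrow> 'v::ab_group_add \<Rightarrow> 'v" +
  fixes H :: "('f::{field, topological_space} ^ 2 ^ 2) set"
    and \<rho> :: "'f ^ 2 ^ 2 \<Rightarrow> 'v \<Rightarrow> 'v"
  assumes linear_action: "h \<in> H \<Longrightarrow> Vector_Spaces.linear smul smul (\<rho> h)"
    and action_one: "\<rho> (mat 1) v = v"
    and action_mult: "g \<in> H \<Longrightarrow> h \<in> H \<Longrightarrow> \<rho> (g ** h) v = \<rho> g (\<rho> h v)"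
    and open_stabilisers: "openin (top_of_set H) {h \<in> H. \<rho> h v = v}"

text \<open>An \<open>H\<close>-equivariant isomorphism of the spaces underlying two representations, whose
  groups may be larger than \<open>H\<close>: this expresses isomorphisms of restrictions.\<close>

definition equivariant_iso ::
  "('f::field ^ 2 ^ 2) set \<Rightarrow> ('k::field \<Rightarrow> 'v::ab_group_add \<Rightarrow> 'v) \<Rightarrow> ('f ^ 2 ^ 2 \<Rightarrow> 'v \<Rightarrow> 'v) \<Rightarrow>
   ('k \<Rightarrow> 'w::ab_group_add \<Rightarrow> 'w) \<Rightarrow> ('f ^ 2 ^ 2 \<Rightarrow> 'w \<Rightarrow> 'w) \<Rightarrow> ('v \<Rightarrow> 'w) \<Rightarrow> bool" where
  "equivariant_iso H smul \<rho> smul' \<rho>' f \<longleftrightarrow>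
     Vector_Spaces.linear smul smul' f \<and> bij f \<and> (\<forall>h\<in>H. \<forall>v. f (\<rho> h v) = \<rho>' h (f v))"

text \<open>\<open>(smul, \<pi>)\<close> is a smooth representation of \<open>GL\<^sub>2(F)\<close> that restricts to \<open>\<rho>\<^sub>0\<close> and \<open>\<rho>\<^sub>1\<close>
  compatibly with \<open>r\<close>.\<close>

definition glues ::
  "('f::{field, topological_space} \<Rightarrow> real) \<Rightarrow> 'f \<Rightarrow>
   ('k::field \<Rightarrow> 'v0::ab_group_add \<Rightarrow> 'v0) \<Rightarrow> ('f ^ 2 ^ 2 \<Rightarrow> 'v0 \<Rightarrow> 'v0) \<Rightarrow>
   ('k \<Rightarrow> 'v1::ab_group_add \<Rightarrow> 'v1) \<Rightarrow> ('f ^ 2 ^ 2 \<Rightarrow> 'v1 \<Rightarrow> 'v1) \<Rightarrow> ('v1 \<Rightarrow> 'v0) \<Rightarrow>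
   ('k \<Rightarrow> 'w::ab_group_add \<Rightarrow> 'w) \<Rightarrow> ('f ^ 2 ^ 2 \<Rightarrow> 'w \<Rightarrow> 'w) \<Rightarrow> bool" where
  "glues av w smul0 \<rho>0 smul1 \<rho>1 r smul \<pi> \<longleftrightarrow>
     smooth_representation smul (carrier GL2) \<pi> \<and>
     (\<exists>\<iota>0 \<iota>1. equivariant_iso (vertex_stabiliser av) smul0 \<rho>0 smul \<pi> \<iota>0 \<and>
              equivariant_iso (edge_stabiliser av w) smul1 \<rho>1 smul \<pi> \<iota>1 \<and>
              \<iota>0 \<circ> r = \<iota>1)"

text \<open>An algebraic closure of the field with \<open>p = CARD('p)\<close> elements.\<close>

type_synonym 'p fp_closure = "'p mod_ring alg_closure"

end

(* The group G acts transitively on the vertices of the tree, and the distance n from sigma_0 to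
   g sigma_0 is read off from |det g| = |w|^n ||g||^2, with the maximum norm on matrices. Carry rho_1
   over to V_0 by r and let T be the resulting action of Pi. An element g at distance n + 1 can be
   written g = k Pi h with k in K(sigma_0) and h at distance n, and k is unique up to right
   multiplication by F^* I, because the first edge of the geodesic from sigma_0 to g sigma_0 is unique.
   So pi(g) = rho_0(k) T pi(h) is a well-defined recursion. It satisfies pi(k g) = rho_0(k) pi(g) and
   pi(Pi g) = T pi(g), and by induction on the distance pi is multiplicative. Uniqueness holds
   because K(sigma_0) and Pi generate G. *)

theory Submission
  imports Defs
begin

(* The two meanings of $ make the number of parse trees exponential. *)
no_notation fps_nth (infixl "$" 75)

section \<open>Two by two matrices, adjugates and inverses\<close>

lemma matrix_mult_2_nth:
  fixes A B :: "'a::semiring_1 ^ 2 ^ 2"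
  shows "(A ** B) $ i $ j = A $ i $ 1 * B $ 1 $ j + A $ i $ 2 * B $ 2 $ j"
  by (simp add: matrix_matrix_mult_def sum_2)

lemma matrix_2_eq_iff:
  fixes A B :: "'a ^ 2 ^ 2"
  shows "A = B \<longleftrightarrow> A $ 1 $ 1 = B $ 1 $ 1 \<and> A $ 1 $ 2 = B $ 1 $ 2 \<and>
    A $ 2 $ 1 = B $ 2 $ 1 \<and> A $ 2 $ 2 = B $ 2 $ 2"
  by (auto simp: vec_eq_iff forall_2)

lemma mat_2_nth [simp]:
  fixes c :: "'a::zero"
  shows "(mat c :: 'a ^ 2 ^ 2) $ 1 $ 1 = c" "(mat c :: 'a ^ 2 ^ 2) $ 1 $ 2 = 0"
    "(mat c :: 'a ^ 2 ^ 2) $ 2 $ 1 = 0" "(mat c :: 'a ^ 2 ^ 2) $ 2 $ 2 = c"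
  by (simp_all add: mat_def)

lemma Pi_matrix_nth [simp]:
  "Pi_matrix w $ 1 $ 1 = 0" "Pi_matrix w $ 1 $ 2 = 1"
  "Pi_matrix w $ 2 $ 1 = w" "Pi_matrix w $ 2 $ 2 = 0"
  by (simp_all add: Pi_matrix_def)

lemma Pi_matrix_square: "Pi_matrix w ** Pi_matrix w = mat w"
  by (simp add: matrix_2_eq_iff matrix_mult_2_nth)

text \<open>For invertible \<open>g\<close> this is the inverse up to the factor
  \<open>det g\<close>. Its entries are those of \<open>g\<close> up to sign and position, so it has
  the same maximum norm, which makes inverses easy to estimate.\<close>

definition adjugate :: "'a::comm_ring_1 ^ 2 ^ 2 \<Rightarrow> 'a ^ 2 ^ 2" where
  "adjugate g = vector [vector [g $ 2 $ 2, - g $ 1 $ 2], vector [- g $ 2 $ 1, g $ 1 $ 1]]"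

lemma adjugate_nth [simp]:
  "adjugate g $ 1 $ 1 = g $ 2 $ 2" "adjugate g $ 1 $ 2 = - g $ 1 $ 2"
  "adjugate g $ 2 $ 1 = - g $ 2 $ 1" "adjugate g $ 2 $ 2 = g $ 1 $ 1"
  by (simp_all add: adjugate_def)

lemma det_adjugate [simp]: "det (adjugate g) = det g"
  by (simp add: det_2 algebra_simps)

lemma adjugate_mult: "adjugate g ** g = mat (det g)" "g ** adjugate g = mat (det g)"
  by (simp_all add: matrix_2_eq_iff matrix_mult_2_nth det_2 algebra_simps)

lemma matrix_inv_2:
  fixes g :: "'a::field ^ 2 ^ 2"
  assumes "det g \<noteq> 0"
  shows "matrix_inv g = mat (inverse (det g)) ** adjugate g"
    and "matrix_inv g ** g = mat 1" and "g ** matrix_inv g = mat 1"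
proof -
  let ?h = "mat (inverse (det g)) ** adjugate g"
  have hg: "?h ** g = mat 1"
    using assms by (simp add: adjugate_mult flip: matrix_mul_assoc)
      (simp add: matrix_2_eq_iff matrix_mult_2_nth)
  have "\<exists>h. g ** h = mat 1 \<and> h ** g = mat 1"
    using hg matrix_left_right_inverse by blast
  then have inv: "g ** matrix_inv g = mat 1 \<and> matrix_inv g ** g = mat 1"
    unfolding matrix_inv_def by (rule someI_ex)
  then show "matrix_inv g ** g = mat 1" "g ** matrix_inv g = mat 1" by simp_all
  have "?h ** (g ** matrix_inv g) = matrix_inv g"
    by (simp add: matrix_mul_assoc hg)
  then show "matrix_inv g = ?h" by (simp add: inv)
qed

lemma group_GL2: "group (GL2 :: ('a::field ^ 2 ^ 2) monoid)"
proof (rule groupI)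
  fix g :: "'a ^ 2 ^ 2" assume "g \<in> carrier GL2"
  then have "det g \<noteq> 0" by (simp add: GL2_def invertible_det_nz)
  then have "matrix_inv g ** g = mat 1" "g ** matrix_inv g = mat 1"
    by (rule matrix_inv_2)+
  then show "\<exists>h\<in>carrier GL2. h \<otimes>\<^bsub>GL2\<^esub> g = \<one>\<^bsub>GL2\<^esub>"
    by (intro bexI[of _ "matrix_inv g"]) (auto simp: GL2_def invertible_def)
qed (auto simp: GL2_def invertible_mult matrix_mul_assoc invertible_det_nz det_mul)

lemma carrier_GL2: "carrier GL2 = {g :: 'a::field ^ 2 ^ 2. det g \<noteq> 0}"
  by (simp add: GL2_def invertible_det_nz)

lemma det_mat_2 [simp]: "det (mat c :: 'a::comm_ring_1 ^ 2 ^ 2) = c\<^sup>2"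
  by (simp add: det_2 power2_eq_square)

lemma det_Pi_matrix [simp]: "det (Pi_matrix w) = - w"
  by (simp add: det_2)

subsection \<open>The absolute value and the maximum norm\<close>

locale uniformised_local_field = nonarch_local_field av
  for av :: "'f::{field, complete_space} \<Rightarrow> real" +
  fixes w :: 'f
  assumes uniformiser: "uniformiser av w"
begin

lemma av_0 [simp]: "av 0 = 0"
  by (simp add: av_eq_0_iff)

lemma av_pos_iff [simp]: "0 < av x \<longleftrightarrow> x \<noteq> 0"
  using av_nonneg[of x] av_eq_0_iff[of x] by linarith

lemma av_1 [simp]: "av 1 = 1"
  using av_mult[of 1 1] av_eq_0_iff[of 1] by simp

lemma av_minus [simp]: "av (- x) = av x"
proof -
  have "(av (- 1))\<^sup>2 = 1" using av_mult[of "- 1" "- 1"] by (simp add: power2_eq_square)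
  then have "av (- 1) = 1" using av_nonneg[of "- 1"] by (auto simp: power2_eq_1_iff)
  then show ?thesis using av_mult[of "- 1" x] by simp
qed

lemma av_inverse: "av (inverse x) = inverse (av x)"
proof (cases "x = 0")
  case False
  then have "av x * av (inverse x) = 1" by (simp flip: av_mult)
  then show ?thesis by (metis inverse_unique)
qed simp

lemma av_divide: "av (x / y) = av x / av y"
  by (simp add: divide_inverse av_mult av_inverse)

lemma av_power: "av (x ^ n) = av x ^ n"
  by (induction n) (simp_all add: av_mult)

lemma av_add_less: "av x < c \<Longrightarrow> av y < c \<Longrightarrow> av (x + y) < c"
  using av_ultrametric[of x y] by linarith

lemma av_add_le: "av x \<le> c \<Longrightarrow> av y \<le> c \<Longrightarrow> av (x + y) \<le> c"
  using av_ultrametric[of x y] by linarith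

lemma av_diff_le: "av x \<le> c \<Longrightarrow> av y \<le> c \<Longrightarrow> av (x - y) \<le> c"
  using av_add_le[of x c "- y"] by simp

text \<open>The estimate from below is the ultrametric inequality for
  \<open>x = (x + y) + (- y)\<close>, in which \<open>y\<close> is too small to be the
  maximum.\<close>

lemma av_add_dominated: "av y < av x \<Longrightarrow> av (x + y) = av x"
  using av_ultrametric[of x y] av_ultrametric[of "x + y" "- y"] by simp

lemma w_nonzero [simp]: "w \<noteq> 0"
  using uniformiser by (simp add: uniformiser_def)

lemma av_w_less_1: "av w < 1"
proof -
  have "w * 1 \<in> max_ideal av"
    using uniformiser by (auto simp: uniformiser_def ring_of_integers_def)
  then show ?thesis by (simp add: max_ideal_def)
qed

text \<open>Discreteness enters here: an element of the maximal ideal is \<open>w\<close> times an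
  integral element, which leaves a gap between \<open>av w\<close> and 1.\<close>

lemma av_le_av_w:
  assumes "av x < 1"
  shows "av x \<le> av w"
proof -
  have "x \<in> max_ideal av" using assms by (simp add: max_ideal_def)
  then obtain y where "x = w * y" "av y \<le> 1"
    using uniformiser by (auto simp: uniformiser_def ring_of_integers_def)
  then show ?thesis by (simp add: av_mult mult_left_le)
qed

lemma av_le_av_w_mult:
  assumes "av x < av y"
  shows "av x \<le> av w * av y"
proof -
  have y: "y \<noteq> 0" using assms av_nonneg[of x] by auto
  have "av (x / y) < 1" using assms y by (simp add: av_divide)
  from av_le_av_w[OF this] show ?thesis using y by (simp add: av_divide pos_divide_le_eq)
qed

lemma ex_av_eq_power:
  assumes "x \<noteq> 0" "av x \<le> 1"
  shows "\<exists>n::nat. av x = av w ^ n"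
proof -
  obtain m where "av w ^ m < av x"
    using real_arch_pow_inv[of "av x" "av w"] assms av_w_less_1 by auto
  then have "\<exists>m. av w ^ m < av x" by blast
  \<comment> \<open>The least exponent \<open>m\<close> is positive, so its predecessor
    \<open>n\<close> has \<open>av x \<le> av w ^ n\<close>. Strict inequality would give
    \<open>av x \<le> av w ^ m\<close> by the gap between values, against the choice of
    \<open>m\<close>.\<close>
  define m where "m = (LEAST m. av w ^ m < av x)"
  have m: "av w ^ m < av x" unfolding m_def by (rule LeastI_ex) fact
  then have "m \<noteq> 0" using assms by (cases m) auto
  then obtain n where n: "m = Suc n" using not0_implies_Suc by blast
  have "av x \<le> av w ^ n"
    using not_less_Least[of n "\<lambda>m. av w ^ m < av x"] n by (simp add: m_def)
  moreover have "\<not> av x < av (w ^ n)"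
    using av_le_av_w_mult[of x "w ^ n"] m n by (auto simp: av_power)
  ultimately show ?thesis by (auto simp: av_power)
qed

section \<open>The maximum norm and its relation to the determinant\<close>

definition row_norm :: "'f ^ 2 \<Rightarrow> real" where
  "row_norm v = max (av (v $ 1)) (av (v $ 2))"

definition matrix_norm :: "'f ^ 2 ^ 2 \<Rightarrow> real" where
  "matrix_norm g = max (row_norm (g $ 1)) (row_norm (g $ 2))"

lemma av_le_row_norm: "av (v $ j) \<le> row_norm v"
  by (cases j rule: exhaust_2[THEN disjE]) (auto simp: row_norm_def)

lemma row_norm_le_matrix_norm: "row_norm (g $ i) \<le> matrix_norm g"
  using exhaust_2[of i] by (auto simp: matrix_norm_def)

lemma av_le_matrix_norm: "av (g $ i $ j) \<le> matrix_norm g"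
  using av_le_row_norm row_norm_le_matrix_norm order_trans by blast

lemma matrix_norm_attained: "\<exists>i j. matrix_norm g = av (g $ i $ j)"
  unfolding matrix_norm_def row_norm_def max_def by auto

lemma row_norm_attained: "\<exists>j. row_norm v = av (v $ j)"
  unfolding row_norm_def max_def by auto

lemma matrix_norm_le_iff: "matrix_norm g \<le> c \<longleftrightarrow> (\<forall>i j. av (g $ i $ j) \<le> c)"
  by (auto simp: matrix_norm_def row_norm_def forall_2)

lemma row_norm_nonneg: "0 \<le> row_norm v"
  using av_le_row_norm[of v 1] av_nonneg order_trans by blast

lemma matrix_norm_nonneg: "0 \<le> matrix_norm g"
  using row_norm_nonneg row_norm_le_matrix_norm order_trans by blast

lemma matrix_norm_mult_le: "matrix_norm (A ** B) \<le> matrix_norm A * matrix_norm B"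
  unfolding matrix_norm_le_iff
  by (auto simp: matrix_mult_2_nth av_mult matrix_norm_nonneg av_nonneg
      intro!: av_add_le mult_mono av_le_matrix_norm)

lemma matrix_norm_mat_mult: "matrix_norm (mat c ** g) = av c * matrix_norm g"
  by (simp add: matrix_norm_def row_norm_def matrix_mult_2_nth av_mult max_mult_distrib_left av_nonneg)

lemma matrix_norm_adjugate: "matrix_norm (adjugate g) = matrix_norm g"
  by (simp add: matrix_norm_def row_norm_def max.commute max.left_commute max.assoc)

text \<open>Each of the two products in the determinant takes one entry from each row.\<close>

lemma av_det_le_row_norms: "av (det g) \<le> row_norm (g $ 1) * row_norm (g $ 2)"
proof -
  have "av (g $ 1 $ 1 * g $ 2 $ 2) \<le> row_norm (g $ 1) * row_norm (g $ 2)"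
    "av (g $ 1 $ 2 * g $ 2 $ 1) \<le> row_norm (g $ 1) * row_norm (g $ 2)"
    by (auto simp: av_mult av_nonneg row_norm_nonneg intro!: mult_mono av_le_row_norm)
  then show ?thesis unfolding det_2 by (rule av_diff_le)
qed

lemma av_det_le: "av (det g) \<le> (matrix_norm g)\<^sup>2"
  unfolding power2_eq_square
  by (rule order_trans[OF av_det_le_row_norms])
    (intro mult_mono row_norm_le_matrix_norm matrix_norm_nonneg row_norm_nonneg)

lemma matrix_norm_pos: "det g \<noteq> 0 \<Longrightarrow> 0 < matrix_norm g"
  using av_det_le[of g] matrix_norm_nonneg[of g] av_nonneg[of "det g"]
  by (cases "matrix_norm g = 0") (auto simp: av_eq_0_iff)

text \<open>Integral matrices have determinants of absolute value at most 1; for \<open>g\<close>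
  and its integral inverse these values multiply to 1. Conversely, the inverse is the adjugate
  divided by a determinant of absolute value 1.\<close>

lemma GL2_integers_iff: "g \<in> GL2_integers av \<longleftrightarrow> matrix_norm g \<le> 1 \<and> av (det g) = 1"
proof
  assume "g \<in> GL2_integers av"
  then obtain h where g: "matrix_norm g \<le> 1" and h: "matrix_norm h \<le> 1" and gh: "g ** h = mat 1"
    by (auto simp: GL2_integers_def ring_of_integers_def matrix_norm_le_iff)
  have "av (det g) * av (det h) = 1"
    by (simp add: gh flip: av_mult det_mul)
  moreover have "av (det g) \<le> 1" "av (det h) \<le> 1"
    using power_le_one[OF matrix_norm_nonneg g, of 2] power_le_one[OF matrix_norm_nonneg h, of 2]
      av_det_le[of g] av_det_le[of h] by linarith+
  ultimately show "matrix_norm g \<le> 1 \<and> av (det g) = 1"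
    using g mult_left_le[of "av (det h)" "av (det g)"] av_nonneg[of "det g"] by linarith
next
  assume g: "matrix_norm g \<le> 1 \<and> av (det g) = 1"
  then have det: "det g \<noteq> 0" by auto
  have "matrix_norm (matrix_inv g) \<le> 1"
    unfolding matrix_inv_2(1)[OF det] using g
    by (simp add: matrix_norm_mat_mult av_inverse matrix_norm_adjugate)
  then show "g \<in> GL2_integers av"
    using g matrix_inv_2[OF det]
    by (auto simp: GL2_integers_def ring_of_integers_def matrix_norm_le_iff)
qed

subsection \<open>Distances in the tree\<close>

text \<open>\<open>depth n g\<close> says that the vertices \<open>\<sigma>\<^sub>0\<close> and \<open>g \<sigma>\<^sub>0\<close> of the tree have distance \<open>n\<close>.\<close>

definition depth :: "nat \<Rightarrow> 'f ^ 2 ^ 2 \<Rightarrow> bool" where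
  "depth n g \<longleftrightarrow> det g \<noteq> 0 \<and> av (det g) = av w ^ n * (matrix_norm g)\<^sup>2"

text \<open>The quotient of \<open>av (det g)\<close> by the squared norm is the absolute value of
  \<open>det g / ?x\<^sup>2\<close>, where \<open>?x\<close> is an entry of maximal absolute value.
  This element is integral and nonzero, so its value is a power of \<open>av w\<close>.\<close>

lemma ex_depth:
  assumes "det g \<noteq> 0"
  shows "\<exists>n. depth n g"
proof -
  obtain i j where ij: "matrix_norm g = av (g $ i $ j)" using matrix_norm_attained by blast
  let ?x = "g $ i $ j"
  have "?x \<noteq> 0" using matrix_norm_pos[OF assms] ij by auto
  have "av (det g / ?x\<^sup>2) \<le> 1"
    using av_det_le[of g] ij \<open>?x \<noteq> 0\<close> by (simp add: av_divide av_power divide_le_eq_1)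
  then obtain n where "av (det g / ?x\<^sup>2) = av w ^ n"
    using ex_av_eq_power[of "det g / ?x\<^sup>2"] assms \<open>?x \<noteq> 0\<close> by auto
  then have "depth n g"
    using assms \<open>?x \<noteq> 0\<close> ij
    by (simp add: depth_def av_divide av_power nonzero_divide_eq_eq av_eq_0_iff)
  then show ?thesis by blast
qed

lemma depth_unique: "depth m g \<Longrightarrow> depth n g \<Longrightarrow> m = n"
  using av_w_less_1 matrix_norm_pos[of g] power_inject_exp'[of "av w" m n]
  by (auto simp: depth_def)

text \<open>A scalar changes both sides of the equation in \<open>depth\<close> by the same factor.
  Conversely, dividing by an entry of maximal absolute value gives norm 1 and a determinant of
  absolute value 1.\<close>

lemma vertex_stabiliser_iff_depth: "g \<in> vertex_stabiliser av \<longleftrightarrow> depth 0 g"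
proof
  assume "g \<in> vertex_stabiliser av"
  then obtain c h where g: "g = mat c ** h" "c \<noteq> 0" and h: "matrix_norm h \<le> 1" "av (det h) = 1"
    by (auto simp: vertex_stabiliser_def scalar_multiples_def GL2_integers_iff)
  have "1 \<le> (matrix_norm h)\<^sup>2" using av_det_le[of h] h by simp
  then have "(matrix_norm h)\<^sup>2 = 1"
    using h(1) matrix_norm_nonneg[of h] by (metis antisym power_le_one)
  moreover have "det h \<noteq> 0" using h by auto
  ultimately show "depth 0 g"
    using g h by (simp add: depth_def det_mul matrix_norm_mat_mult av_mult av_power power_mult_distrib)
next
  assume *: "depth 0 g"
  obtain i j where ij: "matrix_norm g = av (g $ i $ j)" using matrix_norm_attained by blast
  let ?x = "g $ i $ j"
  have x: "?x \<noteq> 0" using matrix_norm_pos[of g] ij * by (auto simp: depth_def)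
  let ?h = "mat (inverse ?x) ** g"
  have "?h \<in> GL2_integers av"
    using * x ij by (simp add: GL2_integers_iff matrix_norm_mat_mult av_inverse det_mul av_mult
        av_power depth_def power_inverse av_eq_0_iff)
  moreover have "g = mat ?x ** ?h" using x by (simp add: matrix_2_eq_iff matrix_mult_2_nth)
  ultimately show "g \<in> vertex_stabiliser av"
    using x by (auto simp: vertex_stabiliser_def scalar_multiples_def)
qed

text \<open>Elements of \<open>GL2_integers av\<close> have norm 1, so the condition on the lower
  left entry can be put in a form that is invariant under scalars.\<close>

lemma scalar_multiples_Iwahori_iff:
  "g \<in> scalar_multiples (Iwahori av) \<longleftrightarrow>
     g \<in> vertex_stabiliser av \<and> av (g $ 2 $ 1) < matrix_norm g"
proof -
  have norm: "matrix_norm h = 1" if "h \<in> GL2_integers av" for h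
  proof -
    have "1 \<le> (matrix_norm h)\<^sup>2" using av_det_le[of h] that by (simp add: GL2_integers_iff)
    then show ?thesis
      using that matrix_norm_nonneg[of h] power_less_one_iff[of "matrix_norm h" 2]
      by (auto simp: GL2_integers_iff le_less)
  qed
  have "av ((mat c ** h) $ 2 $ 1) < matrix_norm (mat c ** h) \<longleftrightarrow> h $ 2 $ 1 \<in> max_ideal av"
    if "c \<noteq> 0" "h \<in> GL2_integers av" for c h
    using that norm[of h] by (simp add: matrix_norm_mat_mult matrix_mult_2_nth av_mult max_ideal_def)
  then show ?thesis
    unfolding vertex_stabiliser_def scalar_multiples_def Iwahori_def by blast
qed

abbreviation (input) "K0 \<equiv> vertex_stabiliser av"
abbreviation (input) "K1 \<equiv> edge_stabiliser av w"
abbreviation (input) "B \<equiv> scalar_multiples (Iwahori av)"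
abbreviation (input) "Pi\<^sub>w \<equiv> Pi_matrix w"

lemma depth_det: "depth n g \<Longrightarrow> det g \<noteq> 0"
  by (simp add: depth_def)

lemma vertex_stabiliser_det: "k \<in> K0 \<Longrightarrow> det k \<noteq> 0"
  by (simp add: vertex_stabiliser_iff_depth depth_det)

lemma av_det_vertex_stabiliser: "k \<in> K0 \<Longrightarrow> av (det k) = (matrix_norm k)\<^sup>2"
  by (simp add: vertex_stabiliser_iff_depth depth_def)

text \<open>The lower bound comes from multiplying back with the adjugate, which has the norm of
  \<open>k\<close>, while \<open>av (det k)\<close> is the square of that norm.\<close>

lemma matrix_norm_vertex_stabiliser_mult:
  assumes "k \<in> K0"
  shows "matrix_norm (k ** g) = matrix_norm k * matrix_norm g"
proof (rule antisym)
  have "av (det k) * matrix_norm g = matrix_norm (adjugate k ** (k ** g))"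
    by (simp add: matrix_mul_assoc adjugate_mult matrix_norm_mat_mult)
  also have "\<dots> \<le> matrix_norm k * matrix_norm (k ** g)"
    using matrix_norm_mult_le[of "adjugate k"] by (simp add: matrix_norm_adjugate)
  finally show "matrix_norm k * matrix_norm g \<le> matrix_norm (k ** g)"
    using matrix_norm_pos[OF vertex_stabiliser_det[OF assms]]
    by (simp add: av_det_vertex_stabiliser assms power2_eq_square mult.assoc)
qed (rule matrix_norm_mult_le)

text \<open>In the tree, \<open>k\<close> fixes sigma_0. In terms of norms, it multiplies
  \<open>av (det g)\<close> and the squared norm of \<open>g\<close> by the same factor.\<close>

lemma depth_vertex_stabiliser_mult [simp]:
  assumes "k \<in> K0"
  shows "depth n (k ** g) \<longleftrightarrow> depth n g"
  using matrix_norm_pos[OF vertex_stabiliser_det[OF assms]] vertex_stabiliser_det[OF assms]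
  by (simp add: depth_def det_mul av_mult matrix_norm_vertex_stabiliser_mult assms
      av_det_vertex_stabiliser power_mult_distrib)

lemma mat_in_vertex_stabiliser [simp]: "c \<noteq> 0 \<Longrightarrow> mat c \<in> K0"
  using matrix_norm_mat_mult[of c "mat 1"]
  by (simp add: vertex_stabiliser_iff_depth depth_def matrix_norm_def row_norm_def av_power)

lemma vertex_stabiliser_mult [simp]: "k \<in> K0 \<Longrightarrow> l \<in> K0 \<Longrightarrow> k ** l \<in> K0"
  by (simp add: vertex_stabiliser_iff_depth depth_vertex_stabiliser_mult[unfolded vertex_stabiliser_iff_depth])

lemma vertex_stabiliser_inv [simp]:
  assumes "k \<in> K0"
  shows "matrix_inv k \<in> K0"
proof -
  have "depth 0 (k ** matrix_inv k)"
    using mat_in_vertex_stabiliser[of 1] vertex_stabiliser_det[OF assms]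
    by (simp add: matrix_inv_2(3) vertex_stabiliser_iff_depth)
  then show ?thesis using assms by (simp add: vertex_stabiliser_iff_depth[of "matrix_inv k"])
qed

section \<open>Left multiplication by Pi and the distance\<close>

lemma Pi_mult_rows:
  "row_norm ((Pi\<^sub>w ** g) $ 1) = row_norm (g $ 2)"
  "row_norm ((Pi\<^sub>w ** g) $ 2) = av w * row_norm (g $ 1)"
  by (simp_all add: row_norm_def matrix_mult_2_nth av_mult av_nonneg max_mult_distrib_left)

lemma matrix_norm_Pi_mult:
  "matrix_norm (Pi\<^sub>w ** g) = max (row_norm (g $ 2)) (av w * row_norm (g $ 1))"
  by (simp add: matrix_norm_def Pi_mult_rows)

text \<open>In the tree, Pi exchanges the ends of sigma_1, and the second row attains the norm iff
  the geodesic from sigma_0 to g sigma_0 does not begin with sigma_1. The norm then stays the same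
  while the determinant gains a factor \<open>- w\<close>.\<close>

lemma depth_Pi_mult_Suc:
  assumes "depth n g" "row_norm (g $ 2) = matrix_norm g"
  shows "depth (Suc n) (Pi\<^sub>w ** g)"
proof -
  have "av w * row_norm (g $ 1) \<le> 1 * matrix_norm g"
    using av_w_less_1 by (intro mult_mono row_norm_le_matrix_norm row_norm_nonneg) auto
  then have "matrix_norm (Pi\<^sub>w ** g) = matrix_norm g"
    using assms(2) by (simp add: matrix_norm_Pi_mult)
  then show ?thesis using assms(1) by (simp add: depth_def det_mul av_mult)
qed

text \<open>By discreteness the second row is smaller than the norm by at least a factor
  \<open>av w\<close>, so Pi scales the norm by exactly \<open>av w\<close>. The squared norm gains
  two such factors, the determinant only one.\<close>

lemma depth_Pi_mult_pred:
  assumes "depth n g" "row_norm (g $ 2) < matrix_norm g"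
  shows "\<exists>m. n = Suc m \<and> depth m (Pi\<^sub>w ** g)"
proof -
  have 1: "row_norm (g $ 1) = matrix_norm g"
    using assms(2) by (auto simp: matrix_norm_def)
  obtain i j where ij: "row_norm (g $ 2) = av (g $ 2 $ i)" "row_norm (g $ 1) = av (g $ 1 $ j)"
    using row_norm_attained by blast
  then have "row_norm (g $ 2) \<le> av w * matrix_norm g"
    using assms(2) 1 by (simp add: av_le_av_w_mult)
  then have norm: "matrix_norm (Pi\<^sub>w ** g) = av w * matrix_norm g"
    using 1 by (simp add: matrix_norm_Pi_mult)
  \<comment> \<open>At depth 0 the determinant has the size of the squared norm, but it is bounded
    by the product of the row norms, which is smaller here.\<close>
  have "n \<noteq> 0"
  proof
    assume "n = 0"
    then have "(matrix_norm g)\<^sup>2 \<le> matrix_norm g * row_norm (g $ 2)"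
      using av_det_le_row_norms[of g] assms(1) 1 by (simp add: depth_def)
    then show False
      using assms(2) row_norm_nonneg[of "g $ 2"] by (simp add: power2_eq_square mult_le_cancel_left)
  qed
  then obtain m where "n = Suc m" using not0_implies_Suc by blast
  then have "depth m (Pi\<^sub>w ** g)"
    using assms(1) norm by (simp add: depth_def det_mul av_mult power2_eq_square)
  then show ?thesis using \<open>n = Suc m\<close> by blast
qed

text \<open>A small second row of \<open>h\<close> would make Pi decrease the depth. So the second
  row of \<open>h\<close> attains the norm and becomes the first row, and the new second row carries
  the factor \<open>w\<close>.\<close>

lemma depth_Suc_Pi_mult_rows:
  assumes "depth n h" "depth (Suc n) (Pi\<^sub>w ** h)"
  shows "row_norm ((Pi\<^sub>w ** h) $ 2) < matrix_norm (Pi\<^sub>w ** h)"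
proof -
  have h: "0 < matrix_norm h" using assms(1) by (simp add: depth_det matrix_norm_pos)
  have "row_norm (h $ 2) = matrix_norm h"
    using depth_Pi_mult_pred[OF assms(1)] depth_unique[OF assms(2)] row_norm_le_matrix_norm[of h 2]
    by fastforce
  moreover have "av w * row_norm (h $ 1) < matrix_norm h"
  proof -
    have "av w * row_norm (h $ 1) \<le> av w * matrix_norm h"
      by (intro mult_left_mono row_norm_le_matrix_norm av_nonneg)
    also have "\<dots> < 1 * matrix_norm h"
      using av_w_less_1 h by (intro mult_strict_right_mono)
    finally show ?thesis by simp
  qed
  ultimately show ?thesis by (simp add: matrix_norm_Pi_mult Pi_mult_rows)
qed

text \<open>Row reduction modulo the maximal ideal: a matrix of positive depth, rescaled to norm 1,
  is singular over the residue field.\<close>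

lemma ex_second_row_small:
  assumes "depth (Suc n) g"
  shows "\<exists>k\<in>K0. row_norm ((k ** g) $ 2) < matrix_norm (k ** g)"
proof (cases "row_norm (g $ 2) < matrix_norm g")
  case True
  then show ?thesis by (intro bexI[of _ "mat 1"]) simp_all
next
  case False
  then have 2: "row_norm (g $ 2) = matrix_norm g"
    using row_norm_le_matrix_norm[of g 2] by simp
  have pos: "0 < matrix_norm g" using assms by (simp add: depth_det matrix_norm_pos)
  have "av w ^ Suc n < 1" using av_w_less_1 by (intro power_Suc_less_one) auto
  then have det: "av (det g) < (matrix_norm g)\<^sup>2"
    using assms pos by (simp add: depth_def mult_less_cancel_right2)
  obtain j where j: "matrix_norm g = av (g $ 2 $ j)" using row_norm_attained 2 by metis
  let ?y = "g $ 2 $ j"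
  have y: "?y \<noteq> 0" using pos j by auto
  \<comment> \<open>The matrix \<open>k\<close> swaps the rows and then clears column
    \<open>j\<close> of the new second row. The other column becomes the determinant divided by
    \<open>?y\<close>, up to sign. This is smaller than the norm because positive depth makes the
    determinant smaller than the squared norm.\<close>
  define t where "t = g $ 1 $ j / ?y"
  define k :: "'f ^ 2 ^ 2" where "k = vector [vector [0, 1], vector [1, - t]]"
  have t: "av t \<le> 1" using av_le_matrix_norm[of g 1 j] y j by (simp add: t_def av_divide divide_le_eq_1)
  have "matrix_norm k = 1" "av (det k) = 1"
    using t by (simp_all add: k_def matrix_norm_def row_norm_def det_2)
  then have k: "k \<in> K0" by (auto simp: vertex_stabiliser_iff_depth depth_def)
  have "av ((k ** g) $ 2 $ i) < matrix_norm g" for i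
  proof -
    have "(k ** g) $ 2 $ i = (g $ 1 $ i * ?y - g $ 1 $ j * g $ 2 $ i) / ?y"
      using y by (simp add: k_def t_def matrix_mult_2_nth field_simps)
    moreover have "av (g $ 1 $ i * ?y - g $ 1 $ j * g $ 2 $ i) \<le> av (det g)"
      using exhaust_2[of i] exhaust_2[of j] av_nonneg[of "det g"] av_minus[of "det g"]
      by (auto simp: det_2 algebra_simps)
    ultimately show ?thesis
      using det y j pos by (simp add: av_divide divide_less_eq power2_eq_square)
  qed
  then have "row_norm ((k ** g) $ 2) < matrix_norm g" using row_norm_attained by metis
  then show ?thesis
    using k \<open>matrix_norm k = 1\<close>
    by (intro bexI[of _ k]) (simp_all add: matrix_norm_vertex_stabiliser_mult)
qed

lemma depth_Suc_decompose:
  assumes "depth (Suc n) g"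
  shows "\<exists>k\<in>K0. \<exists>h. depth n h \<and> g = k ** (Pi\<^sub>w ** h)"
proof -
  obtain k where k: "k \<in> K0" and "row_norm ((k ** g) $ 2) < matrix_norm (k ** g)"
    using ex_second_row_small[OF assms] by blast
  then have h: "depth n (Pi\<^sub>w ** (k ** g))"
    using depth_Pi_mult_pred[of "Suc n" "k ** g"] assms k by auto
  \<comment> \<open>Since Pi squared is the scalar \<open>w\<close>, Pi is its own inverse up to a
    scalar, and that scalar is absorbed into the factor from \<open>K0\<close>.\<close>
  let ?l = "matrix_inv k ** mat (inverse w)"
  have "?l ** (Pi\<^sub>w ** (Pi\<^sub>w ** (k ** g))) = matrix_inv k ** (mat (inverse w) ** mat w) ** k ** g"
    by (simp add: matrix_mul_assoc flip: Pi_matrix_square)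
  also have "mat (inverse w) ** mat w = (mat 1 :: 'f ^ 2 ^ 2)"
    by (simp add: matrix_2_eq_iff matrix_mult_2_nth)
  finally have "g = ?l ** (Pi\<^sub>w ** (Pi\<^sub>w ** (k ** g)))"
    using k by (simp add: matrix_inv_2(2) vertex_stabiliser_det)
  then show ?thesis using h k by (intro bexI[of _ ?l]) auto
qed

text \<open>Induction on the distance, with the distance itself hidden: this is the form in which
  generation of G by \<open>K0\<close> and Pi is used for multiplicativity, linearity and
  uniqueness.\<close>

lemma GL2_induct [consumes 1, case_names vertex Pi]:
  assumes "det g \<noteq> 0"
    and vertex: "\<And>k. k \<in> K0 \<Longrightarrow> P k"
    and Pi: "\<And>k h. k \<in> K0 \<Longrightarrow> det h \<noteq> 0 \<Longrightarrow> P h \<Longrightarrow> P (k ** (Pi\<^sub>w ** h))"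
  shows "P g"
proof -
  obtain n where "depth n g" using ex_depth[OF assms(1)] by blast
  then show ?thesis
  proof (induction n arbitrary: g)
    case 0
    then show ?case by (simp add: vertex vertex_stabiliser_iff_depth)
  next
    case (Suc n)
    then show ?case by (metis depth_Suc_decompose depth_det Pi)
  qed
qed

section \<open>The Iwahori subgroup and the first edge of a geodesic\<close>

lemma scalar_multiples_Iwahori_subset: "B \<subseteq> K0"
  by (auto simp: scalar_multiples_Iwahori_iff)

text \<open>In the tree: an element of \<open>K0\<close> that preserves the first edge of a geodesic fixes that edge.\<close>

lemma in_scalar_multiples_Iwahori:
  assumes "b \<in> K0" "row_norm (g $ 2) < matrix_norm g"
    and "row_norm ((b ** g) $ 2) < matrix_norm (b ** g)"
  shows "b \<in> B"
proof (rule ccontr)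
  assume "b \<notin> B"
  then have b21: "av (b $ 2 $ 1) = matrix_norm b"
    using assms(1) av_le_matrix_norm[of b 2 1] by (auto simp: scalar_multiples_Iwahori_iff)
  have b: "0 < matrix_norm b" using assms(1) by (simp add: vertex_stabiliser_det matrix_norm_pos)
  obtain j where j: "matrix_norm g = av (g $ 1 $ j)"
    using row_norm_attained[of "g $ 1"] assms(2) by (auto simp: matrix_norm_def max_def split: if_splits)
  \<comment> \<open>In column \<open>j\<close>, where the first row of \<open>g\<close> attains the
    norm, the term with the lower left entry of \<open>b\<close> strictly dominates. So the second
    row of \<open>b ** g\<close> attains the norm.\<close>
  have "av (b $ 2 $ 2 * g $ 2 $ j) \<le> matrix_norm b * row_norm (g $ 2)"
    unfolding av_mult by (intro mult_mono av_le_matrix_norm av_le_row_norm matrix_norm_nonneg av_nonneg)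
  also have "\<dots> < av (b $ 2 $ 1 * g $ 1 $ j)"
    using assms(2) b b21 j by (simp add: av_mult)
  finally have "av ((b ** g) $ 2 $ j) = matrix_norm b * matrix_norm g"
    using b21 j by (simp add: matrix_mult_2_nth av_add_dominated av_mult)
  then show False
    using assms(3) av_le_row_norm[of "(b ** g) $ 2" j]
    by (simp add: matrix_norm_vertex_stabiliser_mult[OF assms(1)])
qed

text \<open>The witness is the conjugate of \<open>b\<close> by Pi. It divides the lower left entry
  by \<open>w\<close>, which is harmless because that entry is at most \<open>av w\<close> times the
  norm.\<close>

lemma Pi_normalises_scalar_multiples_Iwahori:
  assumes "b \<in> B"
  shows "\<exists>c\<in>B. b ** Pi\<^sub>w = Pi\<^sub>w ** c"
proof
  let ?c = "vector [vector [b $ 2 $ 2, b $ 2 $ 1 / w], vector [w * b $ 1 $ 2, b $ 1 $ 1]] :: 'f ^ 2 ^ 2"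
  show eq: "b ** Pi\<^sub>w = Pi\<^sub>w ** ?c"
    by (simp add: matrix_2_eq_iff matrix_mult_2_nth mult.commute)
  have b: "b \<in> K0" "av (b $ 2 $ 1) < matrix_norm b"
    using assms by (auto simp: scalar_multiples_Iwahori_iff)
  have pos: "0 < matrix_norm b" using b(1) by (simp add: vertex_stabiliser_det matrix_norm_pos)
  have w: "av w * matrix_norm b < matrix_norm b"
    using pos av_w_less_1 by simp
  obtain i j where ij: "matrix_norm b = av (b $ i $ j)" using matrix_norm_attained by blast
  have 21: "av (b $ 2 $ 1 / w) \<le> matrix_norm b"
    using av_le_av_w_mult[of "b $ 2 $ 1" "b $ i $ j"] b(2) ij
    by (simp add: av_divide divide_le_eq mult.commute)
  have 12: "av (w * b $ 1 $ 2) \<le> av w * matrix_norm b"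
    by (simp add: av_mult av_le_matrix_norm mult_left_mono av_nonneg)
  have det: "det ?c = det b"
    by (simp add: det_2)
  have le: "matrix_norm ?c \<le> matrix_norm b"
    using 21 12 w av_le_matrix_norm[of b 1 1] av_le_matrix_norm[of b 2 2]
    by (simp add: matrix_norm_def row_norm_def)
  \<comment> \<open>Conjugation preserves the determinant, whose size is the squared norm of
    \<open>b\<close>; this bounds the norm of \<open>?c\<close> from below.\<close>
  have "(matrix_norm b)\<^sup>2 \<le> (matrix_norm ?c)\<^sup>2"
    using av_det_le[of ?c] by (simp add: det av_det_vertex_stabiliser b(1))
  then have "matrix_norm b \<le> matrix_norm ?c"
    using matrix_norm_nonneg by (rule power2_le_imp_le)
  with le have norm: "matrix_norm ?c = matrix_norm b" by simp
  then have "?c \<in> K0"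
    using b(1) by (simp add: vertex_stabiliser_iff_depth depth_def det)
  then show "?c \<in> B"
    using norm 12 w by (simp add: scalar_multiples_Iwahori_iff)
qed

subsection \<open>Topology and the edge stabiliser\<close>

text \<open>Continuity of the field operations is read off from \<open>dist_av\<close>:
  multiplication by \<open>c\<close> scales distances by \<open>av c\<close>, and addition does not
  increase the larger of two distances.\<close>

lemma continuous_on_matrix_mult_left: "continuous_on UNIV (\<lambda>x :: 'f ^ 2 ^ 2. g ** x)"
proof -
  have mult: "continuous_on UNIV (\<lambda>x. c * x)" for c :: 'f
  proof (cases "c = 0")
    case False
    show ?thesis
      unfolding continuous_on_iff
    proof (intro ballI allI impI)
      fix x :: 'f and e :: real assume "0 < e"
      have "dist (c * y) (c * x) < e" if "dist y x < e / av c" for y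
        using that False by (simp add: dist_av av_mult pos_less_divide_eq mult.commute flip: right_diff_distrib)
      then show "\<exists>d>0. \<forall>y\<in>UNIV. dist y x < d \<longrightarrow> dist (c * y) (c * x) < e"
        using \<open>0 < e\<close> False by (intro exI[of _ "e / av c"]) simp
    qed
  qed simp
  have add: "continuous_on UNIV (\<lambda>p :: 'f \<times> 'f. fst p + snd p)"
    unfolding continuous_on_iff
  proof (intro ballI allI impI)
    fix p :: "'f \<times> 'f" and e :: real assume "0 < e"
    have "dist (fst q + snd q) (fst p + snd p) < e" if "dist q p < e" for q
    proof -
      have "av (fst q - fst p) < e" "av (snd q - snd p) < e"
        using that dist_fst_le[of q p] dist_snd_le[of q p] by (simp_all add: dist_av)
      then have "av ((fst q - fst p) + (snd q - snd p)) < e" by (rule av_add_less)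
      then show ?thesis by (simp add: dist_av algebra_simps)
    qed
    then show "\<exists>d>0. \<forall>q\<in>UNIV. dist q p < d \<longrightarrow> dist (fst q + snd q) (fst p + snd p) < e"
      using \<open>0 < e\<close> by blast
  qed
  have entry: "continuous_on UNIV (\<lambda>x :: 'f ^ 2 ^ 2. a * x $ 1 $ j + b * x $ 2 $ j)" for a b :: 'f and j
    by (rule continuous_on_compose2[OF add, of UNIV
          "\<lambda>x :: 'f ^ 2 ^ 2. (a * x $ 1 $ j, b * x $ 2 $ j)", simplified])
      (intro continuous_on_Pair continuous_on_compose2[OF mult] continuous_on_component
        continuous_on_id subset_UNIV)
  have "(\<lambda>x :: 'f ^ 2 ^ 2. g ** x) = (\<lambda>x. \<chi> i j. g $ i $ 1 * x $ 1 $ j + g $ i $ 2 * x $ 2 $ j)"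
    unfolding fun_eq_iff vec_eq_iff by (simp add: matrix_matrix_mult_def sum_2)
  then show ?thesis by (simp add: continuous_on_vec_lambda entry)
qed

text \<open>Near the identity the diagonal entries are units and the others lie in the maximal
  ideal, so the determinant is a unit. Hence openness of stabilisers in G can be tested inside
  \<open>K0\<close>.\<close>

lemma vertex_stabiliser_neighbourhood:
  "\<exists>U. open U \<and> mat 1 \<in> U \<and> U \<subseteq> vertex_stabiliser av"
proof (intro exI conjI)
  let ?U = "{g :: 'f ^ 2 ^ 2. \<forall>i. g $ i \<in> {v. \<forall>j. v $ j \<in> ball (mat 1 $ i $ j) 1}}"
  show "open ?U" by (intro open_vector_box allI open_ball)
  show "mat 1 \<in> ?U" by simp
  show "?U \<subseteq> vertex_stabiliser av"
  proof
    fix g assume "g \<in> ?U"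
    then have g: "av (g $ i $ j - mat 1 $ i $ j) < 1" for i j
      by (auto simp: dist_commute simp flip: dist_av)
    have diag: "av x = 1" if "av (x - 1) < 1" for x
      using av_add_dominated[of "x - 1" 1] that by simp
    have entries: "av (g $ 1 $ 1) = 1" "av (g $ 2 $ 2) = 1" "av (g $ 1 $ 2) < 1" "av (g $ 2 $ 1) < 1"
      using g[of 1 1] g[of 1 2] g[of 2 1] g[of 2 2] diag by auto
    then have norm: "matrix_norm g = 1" by (simp add: matrix_norm_def row_norm_def)
    have "av (g $ 1 $ 2 * g $ 2 $ 1) < 1"
      using entries mult_strict_mono[of "av (g $ 1 $ 2)" 1 "av (g $ 2 $ 1)" 1]
      by (simp add: av_mult av_nonneg)
    then have "av (det g) = 1"
      using entries av_add_dominated[of "- (g $ 1 $ 2 * g $ 2 $ 1)" "g $ 1 $ 1 * g $ 2 $ 2"]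
      by (simp add: det_2 av_mult)
    then show "g \<in> vertex_stabiliser av"
      using norm by (auto simp: vertex_stabiliser_iff_depth depth_def)
  qed
qed

section \<open>The group generated by Pi and the Iwahori subgroup\<close>

lemma edge_generators_subset: "insert Pi\<^sub>w (Iwahori av) \<subseteq> carrier GL2"
  by (auto simp: carrier_GL2 Iwahori_def GL2_integers_iff)

lemma edge_stabiliser_det:
  assumes "g \<in> K1"
  shows "det g \<noteq> 0"
proof -
  have "g \<in> carrier GL2"
    using assms group.generate_incl[OF group_GL2 edge_generators_subset]
    unfolding edge_stabiliser_def by blast
  then show ?thesis by (simp add: carrier_GL2)
qed

lemma edge_stabiliser_mult: "g \<in> K1 \<Longrightarrow> h \<in> K1 \<Longrightarrow> g ** h \<in> K1"
  using generate.eng[of g GL2 _ h] by (simp add: edge_stabiliser_def) (simp add: GL2_def)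

lemma edge_stabiliser_inv:
  assumes "g \<in> K1" "h ** g = mat 1"
  shows "h \<in> K1"
proof -
  have "det g \<noteq> 0" using assms(1) by (rule edge_stabiliser_det)
  moreover have "det h \<noteq> 0"
    using assms(2) by (metis det_I det_mul mult_zero_left zero_neq_one)
  ultimately have "inv\<^bsub>GL2\<^esub> g = h"
    using assms(2) by (intro group.inv_equality[OF group_GL2]) (simp_all add: GL2_def invertible_det_nz)
  then show ?thesis
    using group.generate_m_inv_closed[OF group_GL2 edge_generators_subset] assms(1)
    unfolding edge_stabiliser_def by blast
qed

lemma Pi_in_edge_stabiliser [simp]: "Pi\<^sub>w \<in> K1"
  by (simp add: edge_stabiliser_def generate.incl)

text \<open>Scalars are not among the generators. Units lie in the Iwahori subgroup, the square of
  Pi supplies powers of \<open>w\<close>, and inverses give the scalars that are not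
  integral.\<close>

lemma mat_in_edge_stabiliser:
  assumes "c \<noteq> 0"
  shows "mat c \<in> K1"
proof -
  have integral: "mat c \<in> K1" if c: "c \<noteq> 0" "av c \<le> 1" for c
  proof -
    obtain n where n: "av c = av w ^ n" using ex_av_eq_power[OF c] by blast
    have unit: "mat (c / w ^ n) \<in> K1"
    proof -
      have "av (c / w ^ n) = 1" using n by (simp add: av_divide av_power av_eq_0_iff)
      then have "(mat (c / w ^ n) :: 'f ^ 2 ^ 2) \<in> Iwahori av"
        by (simp add: Iwahori_def GL2_integers_iff max_ideal_def matrix_norm_def row_norm_def av_power)
      then show ?thesis by (simp add: edge_stabiliser_def generate.incl)
    qed
    have "mat (w ^ m * (c / w ^ n)) \<in> K1" for m
    proof (induction m)
      case (Suc m)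
      have "Pi\<^sub>w ** (Pi\<^sub>w ** mat (w ^ m * (c / w ^ n))) \<in> K1"
        by (intro edge_stabiliser_mult Suc.IH Pi_in_edge_stabiliser)
      also have "Pi\<^sub>w ** (Pi\<^sub>w ** mat (w ^ m * (c / w ^ n))) = mat (w ^ Suc m * (c / w ^ n))"
        by (simp add: matrix_2_eq_iff matrix_mult_2_nth)
      finally show ?case .
    qed (simp add: unit)
    from this[of n] show ?thesis by simp
  qed
  show ?thesis
  proof (cases "av c \<le> 1")
    case False
    then have "mat (inverse c) \<in> K1"
      using assms by (intro integral) (simp_all add: av_inverse inverse_le_1_iff)
    then show ?thesis
      by (rule edge_stabiliser_inv) (simp add: matrix_2_eq_iff matrix_mult_2_nth assms)
  qed (rule integral[OF assms])
qed

lemma scalar_multiples_Iwahori_subset_edge_stabiliser: "B \<subseteq> K1"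
proof
  fix g assume "g \<in> B"
  then obtain c h where "g = mat c ** h" "c \<noteq> 0" "h \<in> Iwahori av"
    by (auto simp: scalar_multiples_def)
  moreover from this have "h \<in> K1" by (simp add: edge_stabiliser_def generate.incl)
  ultimately show "g \<in> K1" by (simp add: edge_stabiliser_mult mat_in_edge_stabiliser)
qed

end

subsection \<open>Gluing\<close>

text \<open>The second representation, carried over to the space of the first, is reduced to the
  action \<open>T\<close> of Pi. The last two assumptions are the relations between Pi and F^* I:
  its square is \<open>w\<close>, and it normalises this subgroup.\<close>

locale amalgamated_action = uniformised_local_field av w +
  rep: smooth_representation smul "vertex_stabiliser av" \<rho>
  for av :: "'f::{field, complete_space} \<Rightarrow> real" and w
    and smul :: "'k::field \<Rightarrow> 'v::ab_group_add \<Rightarrow> 'v" and \<rho> +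
  fixes T :: "'v \<Rightarrow> 'v"
  assumes T_linear: "Vector_Spaces.linear smul smul T"
    and T_square: "T (T v) = \<rho> (mat w) v"
    and T_intertwines: "\<lbrakk>b \<in> scalar_multiples (Iwahori av); c \<in> scalar_multiples (Iwahori av);
      b ** Pi_matrix w = Pi_matrix w ** c\<rbrakk> \<Longrightarrow> \<rho> b (T v) = T (\<rho> c v)"
begin

text \<open>The choice is arbitrary: the pair is determined only up to replacing
  \<open>(k, h)\<close> by \<open>(k ** b, h')\<close> with \<open>b\<close> in \<open>B\<close> and
  \<open>b ** Pi\<^sub>w ** h' = Pi\<^sub>w ** h\<close>.\<close>

definition first_step :: "nat \<Rightarrow> 'f ^ 2 ^ 2 \<Rightarrow> ('f ^ 2 ^ 2) \<times> ('f ^ 2 ^ 2)" where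
  "first_step n g = (SOME p. fst p \<in> K0 \<and> depth n (snd p) \<and> g = fst p ** (Pi\<^sub>w ** snd p))"

text \<open>The distance is an explicit argument, which makes the recursion primitive;
  \<open>act n g\<close> is meaningful only under \<open>depth n g\<close>.\<close>

primrec act :: "nat \<Rightarrow> 'f ^ 2 ^ 2 \<Rightarrow> 'v \<Rightarrow> 'v" where
  "act 0 = \<rho>"
| "act (Suc n) = (\<lambda>g v. \<rho> (fst (first_step n g)) (T (act n (snd (first_step n g)) v)))"

text \<open>Independence of the choice in \<open>first_step\<close>: two decompositions differ by
  some \<open>b\<close> that keeps the first edge, hence lies in \<open>B\<close>. Moved past Pi it
  becomes \<open>c\<close>, which \<open>vertex_mult\<close> pulls out of \<open>act n\<close>. That
  premise is the induction hypothesis of the next lemma.\<close>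

lemma act_Suc_eq:
  assumes vertex_mult: "\<And>g k v. depth n g \<Longrightarrow> k \<in> K0 \<Longrightarrow> act n (k ** g) v = \<rho> k (act n g v)"
    and k: "k \<in> K0" and h: "depth n h" "depth (Suc n) (Pi\<^sub>w ** h)"
  shows "act (Suc n) (k ** (Pi\<^sub>w ** h)) v = \<rho> k (T (act n h v))"
proof -
  define g where "g = k ** (Pi\<^sub>w ** h)"
  define k' h' where "k' = fst (first_step n g)" and "h' = snd (first_step n g)"
  have "\<exists>p. fst p \<in> K0 \<and> depth n (snd p) \<and> g = fst p ** (Pi\<^sub>w ** snd p)"
    using k h(1) by (intro exI[of _ "(k, h)"]) (simp add: g_def)
  from someI_ex[OF this] have k': "k' \<in> K0" "depth n h'" and g': "g = k' ** (Pi\<^sub>w ** h')"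
    by (simp_all add: k'_def h'_def first_step_def)
  define b where "b = matrix_inv k' ** k"
  have det_k': "det k' \<noteq> 0" using k'(1) by (rule vertex_stabiliser_det)
  have b: "b \<in> K0" using k k' by (simp add: b_def)
  have k'b: "k' ** b = k" by (simp add: b_def matrix_mul_assoc matrix_inv_2(3) det_k')
  have "b ** (Pi\<^sub>w ** h) = matrix_inv k' ** g"
    by (simp add: b_def g_def matrix_mul_assoc)
  also have "\<dots> = Pi\<^sub>w ** h'"
    unfolding g' by (simp add: matrix_mul_assoc matrix_inv_2(2) det_k')
  finally have bh: "b ** (Pi\<^sub>w ** h) = Pi\<^sub>w ** h'" .
  then have "depth (Suc n) (Pi\<^sub>w ** h')" using h(2) b by (metis depth_vertex_stabiliser_mult)
  then have "b \<in> B"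
    using b h k'(2) bh by (metis depth_Suc_Pi_mult_rows in_scalar_multiples_Iwahori)
  then obtain c where c: "c \<in> B" "b ** Pi\<^sub>w = Pi\<^sub>w ** c"
    using Pi_normalises_scalar_multiples_Iwahori by blast
  have "matrix_inv Pi\<^sub>w ** (Pi\<^sub>w ** h') = matrix_inv Pi\<^sub>w ** (Pi\<^sub>w ** (c ** h))"
    using bh c(2) by (simp add: matrix_mul_assoc)
  then have "h' = c ** h" by (simp add: matrix_mul_assoc matrix_inv_2(2))
  then have "act n h' v = \<rho> c (act n h v)"
    using vertex_mult[OF h(1)] c(1) scalar_multiples_Iwahori_subset by blast
  then have "\<rho> k' (T (act n h' v)) = \<rho> k' (\<rho> b (T (act n h v)))"
    using T_intertwines[OF \<open>b \<in> B\<close> c] by simp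
  also have "\<dots> = \<rho> k (T (act n h v))"
    using rep.action_mult[OF k'(1) b] by (simp add: k'b)
  finally show ?thesis
    unfolding g_def[symmetric] by (simp add: k'_def h'_def)
qed

text \<open>A decomposition of \<open>g\<close> with first factor \<open>l\<close> gives one of
  \<open>k ** g\<close> with first factor \<open>k ** l\<close>, and independence of the choice
  evaluates both sides.\<close>

lemma act_vertex_mult:
  assumes "depth n g" "k \<in> K0"
  shows "act n (k ** g) v = \<rho> k (act n g v)"
  using assms
proof (induction n arbitrary: g k v)
  case 0
  then show ?case by (simp add: rep.action_mult vertex_stabiliser_iff_depth)
next
  case (Suc n)
  obtain l h where l: "l \<in> K0" and h: "depth n h" and g: "g = l ** (Pi\<^sub>w ** h)"
    using depth_Suc_decompose[OF Suc.prems(1)] by blast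
  have h': "depth (Suc n) (Pi\<^sub>w ** h)" using Suc.prems(1) l by (simp add: g)
  have "act (Suc n) (k ** g) v = act (Suc n) ((k ** l) ** (Pi\<^sub>w ** h)) v"
    by (simp add: g matrix_mul_assoc)
  also have "\<dots> = \<rho> (k ** l) (T (act n h v))"
    using Suc.prems(2) l h h' by (intro act_Suc_eq Suc.IH) simp_all
  also have "\<dots> = \<rho> k (\<rho> l (T (act n h v)))"
    using Suc.prems(2) l by (rule rep.action_mult)
  also have "\<rho> l (T (act n h v)) = act (Suc n) g v"
    unfolding g using l h h' by (intro act_Suc_eq[symmetric] Suc.IH)
  finally show ?case .
qed

section \<open>The glued action of the whole group\<close>

definition glued :: "'f ^ 2 ^ 2 \<Rightarrow> 'v \<Rightarrow> 'v" where
  "glued g = act (THE n. depth n g) g"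

lemma glued_eq_act: "depth n g \<Longrightarrow> glued g = act n g"
  unfolding glued_def by (metis depth_unique the_equality)

lemma glued_vertex: "k \<in> K0 \<Longrightarrow> glued k = \<rho> k"
  by (simp add: glued_eq_act vertex_stabiliser_iff_depth)

lemma glued_vertex_mult:
  assumes "det g \<noteq> 0" "k \<in> K0"
  shows "glued (k ** g) v = \<rho> k (glued g v)"
proof -
  obtain n where "depth n g" using ex_depth[OF assms(1)] by blast
  then show ?thesis using assms(2) by (simp add: glued_eq_act[of n] act_vertex_mult)
qed

text \<open>If Pi leads away from sigma_0, this is the recursion with \<open>k = mat 1\<close>. If
  it leads back, the recursion is applied to \<open>Pi\<^sub>w ** g\<close> instead, and Pi squared
  being \<open>w\<close> turns it around.\<close>

lemma glued_Pi_mult: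
  assumes "det g \<noteq> 0"
  shows "glued (Pi\<^sub>w ** g) v = T (glued g v)"
proof -
  have away: "glued (Pi\<^sub>w ** h) v = T (glued h v)" if "depth n h" "depth (Suc n) (Pi\<^sub>w ** h)" for n h v
    using act_Suc_eq[OF act_vertex_mult, of n "mat 1" h v] that
    by (simp add: glued_eq_act rep.action_one del: act.simps)
  obtain n where n: "depth n g" using ex_depth[OF assms(1)] by blast
  show ?thesis
  proof (cases "row_norm (g $ 2) = matrix_norm g")
    case True
    then show ?thesis using away n depth_Pi_mult_Suc by blast
  next
    case False
    then have "row_norm (g $ 2) < matrix_norm g"
      using row_norm_le_matrix_norm[of g 2] by simp
    then obtain m where m: "n = Suc m" "depth m (Pi\<^sub>w ** g)"
      using depth_Pi_mult_pred[OF n] by blast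
    have PiPi: "Pi\<^sub>w ** (Pi\<^sub>w ** g) = mat w ** g"
      by (simp add: matrix_mul_assoc Pi_matrix_square)
    have "\<rho> (mat w) (glued g v) = glued (Pi\<^sub>w ** (Pi\<^sub>w ** g)) v"
      by (simp add: PiPi glued_vertex_mult assms)
    also have "\<dots> = T (glued (Pi\<^sub>w ** g) v)"
      using m n by (intro away[of m]) (simp_all add: PiPi)
    finally have "T (T (glued g v)) = T (glued (Pi\<^sub>w ** g) v)"
      by (simp add: T_square)
    \<comment> \<open>The outer \<open>T\<close> is cancelled by applying \<open>T\<close> once
      more: its square is the action of the invertible scalar \<open>w\<close>.\<close>
    then have "\<rho> (mat w) (T (glued g v)) = \<rho> (mat w) (glued (Pi\<^sub>w ** g) v)"
      by (metis T_square)
    then have "\<rho> (mat (inverse w) ** mat w) (T (glued g v)) =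
        \<rho> (mat (inverse w) ** mat w) (glued (Pi\<^sub>w ** g) v)"
      by (simp add: rep.action_mult)
    moreover have "mat (inverse w) ** mat w = (mat 1 :: 'f ^ 2 ^ 2)"
      by (simp add: matrix_2_eq_iff matrix_mult_2_nth)
    ultimately show ?thesis by (simp add: rep.action_one)
  qed
qed

text \<open>Only \<open>g\<close> is decomposed, because the rules for left multiplication by
  \<open>K0\<close> and by Pi hold for any invertible right factor.\<close>

lemma glued_mult:
  assumes "det g \<noteq> 0" "det h \<noteq> 0"
  shows "glued (g ** h) v = glued g (glued h v)"
  using assms
proof (induction g rule: GL2_induct)
  case (Pi k g)
  have "glued (k ** (Pi\<^sub>w ** g) ** h) v = glued (k ** (Pi\<^sub>w ** (g ** h))) v"
    by (simp add: matrix_mul_assoc)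
  then show ?case
    using Pi assms(2) by (simp add: glued_vertex_mult glued_Pi_mult det_mul)
qed (simp add: glued_vertex_mult glued_vertex)

lemma linear_glued:
  assumes "det g \<noteq> 0"
  shows "Vector_Spaces.linear smul smul (glued g)"
  using assms
proof (induction g rule: GL2_induct)
  case (Pi k g)
  have "glued (k ** (Pi\<^sub>w ** g)) = \<rho> k \<circ> (T \<circ> glued g)"
    using Pi by (auto simp: glued_vertex_mult glued_Pi_mult det_mul)
  moreover have "Vector_Spaces.linear smul smul (\<rho> k \<circ> (T \<circ> glued g))"
    using Pi rep.linear_action T_linear by (blast intro: Vector_Spaces.linear_compose)
  ultimately show ?case by (simp only:)
qed (simp add: glued_vertex rep.linear_action)

lemma open_stabilisers_glued:
  "openin (top_of_set (carrier GL2)) {g \<in> carrier GL2. glued g v = v}"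
proof (subst openin_subopen, intro ballI)
  fix g assume "g \<in> {g \<in> carrier GL2. glued g v = v}"
  then have g: "det g \<noteq> 0" "glued g v = v" by (auto simp: carrier_GL2)
  obtain S where S: "open S" "{k \<in> K0. \<rho> k v = v} = K0 \<inter> S"
    using rep.open_stabilisers[of v] by (auto simp: openin_open)
  obtain U where U: "open U" "mat 1 \<in> U" "U \<subseteq> K0"
    using vertex_stabiliser_neighbourhood by blast
  \<comment> \<open>Translation by \<open>g\<close> reduces the claim to the identity:
    \<open>U\<close> forces the quotient into \<open>K0\<close>, and there \<open>S\<close> cuts out
    the stabiliser of \<open>v\<close>.\<close>
  let ?W = "(\<lambda>x. matrix_inv g ** x) -` (S \<inter> U)"
  have "open ?W"
    using S(1) U(1) continuous_on_matrix_mult_left by (intro open_vimage open_Int)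
  then have "openin (top_of_set (carrier GL2)) (carrier GL2 \<inter> ?W)"
    by (simp add: openin_open_Int)
  moreover have "g \<in> carrier GL2 \<inter> ?W"
    using g S(2) U rep.action_one by (auto simp: carrier_GL2 matrix_inv_2(2))
  moreover have "carrier GL2 \<inter> ?W \<subseteq> {g \<in> carrier GL2. glued g v = v}"
  proof
    fix x assume x: "x \<in> carrier GL2 \<inter> ?W"
    let ?k = "matrix_inv g ** x"
    have k: "?k \<in> K0" "\<rho> ?k v = v" using x S(2) U(3) by auto
    have "x = g ** ?k" by (simp add: matrix_mul_assoc matrix_inv_2(3) g)
    then have "glued x v = glued g (glued ?k v)"
      using glued_mult[OF g(1) vertex_stabiliser_det[OF k(1)]] by simp
    then show "x \<in> {g \<in> carrier GL2. glued g v = v}"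
      using x g k by (simp add: glued_vertex)
  qed
  ultimately show "\<exists>W. openin (top_of_set (carrier GL2)) W \<and> g \<in> W \<and>
      W \<subseteq> {g \<in> carrier GL2. glued g v = v}"
    by blast
qed

lemma smooth_representation_glued: "smooth_representation smul (carrier GL2) glued"
proof (intro smooth_representation.intro smooth_representation_axioms.intro)
  show "vector_space smul" by (rule rep.vector_space_axioms)
  show "Vector_Spaces.linear smul smul (glued g)" if "g \<in> carrier GL2" for g
    using that by (simp add: carrier_GL2 linear_glued)
  show "glued (mat 1) v = v" for v
    by (simp add: glued_vertex rep.action_one)
  show "glued (g ** h) v = glued g (glued h v)" if "g \<in> carrier GL2" "h \<in> carrier GL2" for g h v
    using that by (simp add: carrier_GL2 glued_mult)
qed (rule open_stabilisers_glued)

lemma glued_Pi: "glued Pi\<^sub>w = T"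
  using glued_Pi_mult[of "mat 1"] by (auto simp: glued_vertex rep.action_one)

end

section \<open>Existence and uniqueness for two representations identified by
  \<open>r\<close>\<close>

lemma linear_inv:
  assumes "Vector_Spaces.linear s1 s2 f" "bij f"
  shows "Vector_Spaces.linear s2 s1 (inv_into UNIV f)"
proof -
  interpret f: Vector_Spaces.linear s1 s2 f by fact
  have [simp]: "f (inv_into UNIV f y) = y" for y using assms(2) by (simp add: bij_is_surj surj_f_inv_f)
  show ?thesis
    by unfold_locales (auto intro!: injD[OF bij_is_inj[OF assms(2)]] simp: f.add f.scale)
qed

context uniformised_local_field
begin

text \<open>The glued representation lives on the space of \<open>\<rho>0\<close>, with the identity
  as iota_0 and \<open>r\<close> as iota_1.\<close>

lemma ex_glues:
  fixes smul0 :: "'k::field \<Rightarrow> 'v0::ab_group_add \<Rightarrow> 'v0"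
    and smul1 :: "'k \<Rightarrow> 'v1::ab_group_add \<Rightarrow> 'v1"
  assumes "smooth_representation smul0 K0 \<rho>0" "smooth_representation smul1 K1 \<rho>1"
    and "equivariant_iso B smul1 \<rho>1 smul0 \<rho>0 r"
  shows "\<exists>\<pi>. glues av w smul0 \<rho>0 smul1 \<rho>1 r smul0 \<pi>"
proof -
  interpret R0: smooth_representation smul0 K0 \<rho>0 by fact
  interpret R1: smooth_representation smul1 K1 \<rho>1 by fact
  have r: "Vector_Spaces.linear smul1 smul0 r" "bij r"
    and equivariant: "\<And>h v. h \<in> B \<Longrightarrow> r (\<rho>1 h v) = \<rho>0 h (r v)"
    using assms(3) by (auto simp: equivariant_iso_def)
  have inv_r [simp]: "r (inv_into UNIV r v) = v" "inv_into UNIV r (r u) = u" for u v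
    using r(2) by (simp_all add: bij_is_surj surj_f_inv_f bij_is_inj)
  have B: "h \<in> K1" if "h \<in> B" for h
    using that scalar_multiples_Iwahori_subset_edge_stabiliser by blast
  define T where "T = r \<circ> \<rho>1 Pi\<^sub>w \<circ> inv_into UNIV r"
  have mat_w: "mat w \<in> B"
    using av_w_less_1 by (simp add: scalar_multiples_Iwahori_iff matrix_norm_pos)
  interpret amalgamated_action av w smul0 \<rho>0 T
  proof (intro amalgamated_action.intro amalgamated_action_axioms.intro)
    show "uniformised_local_field av w" "smooth_representation smul0 K0 \<rho>0" 
      by (rule uniformised_local_field_axioms) fact
    show "Vector_Spaces.linear smul0 smul0 T"
      unfolding T_def using r R1.linear_action[OF Pi_in_edge_stabiliser]
      by (blast intro: Vector_Spaces.linear_compose linear_inv)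
    show "T (T v) = \<rho>0 (mat w) v" for v
      using R1.action_mult[OF Pi_in_edge_stabiliser Pi_in_edge_stabiliser, of "inv_into UNIV r v"]
        equivariant[OF mat_w, of "inv_into UNIV r v"]
      by (simp add: T_def Pi_matrix_square)
    show "\<rho>0 b (T v) = T (\<rho>0 c v)"
      if "b \<in> B" "c \<in> B" "b ** Pi\<^sub>w = Pi\<^sub>w ** c" for b c v
    proof -
      have "\<rho>0 b (T v) = r (\<rho>1 (b ** Pi\<^sub>w) (inv_into UNIV r v))"
        by (simp add: T_def equivariant[OF that(1), symmetric] R1.action_mult B that(1))
      also have "\<dots> = r (\<rho>1 Pi\<^sub>w (inv_into UNIV r (r (\<rho>1 c (inv_into UNIV r v)))))"
        by (simp add: that(3) R1.action_mult B that(2))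
      also have "\<dots> = T (\<rho>0 c v)"
        by (simp only: equivariant[OF that(2)] T_def o_apply inv_r)
      finally show ?thesis .
    qed
  qed
  \<comment> \<open>It is enough to check the generators of \<open>K1\<close>: for Pi this is the
    definition of \<open>T\<close>, for the Iwahori subgroup the equivariance of
    \<open>r\<close>.\<close>
  have restrict: "r (\<rho>1 h v) = glued h (r v)" if "h \<in> K1" for h v
  proof -
    have gen: "r (\<rho>1 h v) = glued h (r v)" if "h \<in> insert Pi\<^sub>w (Iwahori av)" for h v
    proof (cases "h = Pi\<^sub>w")
      case True
      have "glued Pi\<^sub>w (r v) = T (r v)" by (simp only: glued_Pi)
      then show ?thesis using True by (simp add: T_def)
    next
      case False
      then have "\<exists>c h'. h = mat c ** h' \<and> c \<noteq> 0 \<and> h' \<in> Iwahori av"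
        using that by (intro exI[of _ 1] exI[of _ h]) simp
      then have "h \<in> B" by (simp add: scalar_multiples_def)
      then show ?thesis
        using equivariant scalar_multiples_Iwahori_subset by (auto simp: glued_vertex)
    qed
    show ?thesis
      using that unfolding edge_stabiliser_def
    proof (induction h arbitrary: v)
      case one
      then show ?case
        by (simp add: GL2_def R1.action_one glued_vertex R0.action_one)
    next
      case (incl h)
      then show ?case by (rule gen)
    next
      case (inv h)
      let ?h' = "inv\<^bsub>GL2\<^esub> h"
      have h: "h \<in> K1" "?h' \<in> K1"
        using inv by (auto simp: edge_stabiliser_def intro: generate.incl generate.inv)
      then have carrier: "h \<in> carrier GL2" "?h' \<in> carrier GL2"
        by (simp_all add: carrier_GL2 edge_stabiliser_det)
      have inverse: "?h' ** h = mat 1" "h ** ?h' = mat 1"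
        using group.l_inv[OF group_GL2 carrier(1)] group.r_inv[OF group_GL2 carrier(1)]
        by (simp_all add: GL2_def)
      \<comment> \<open>For an inverse, the rule for \<open>h\<close> itself is applied to the
        vector \<open>\<rho>1 ?h' v\<close>, and \<open>glued h\<close> is then undone.\<close>
      have "glued ?h' (glued h (r (\<rho>1 ?h' v))) = r (\<rho>1 ?h' v)"
        using carrier by (simp add: inverse glued_vertex R0.action_one carrier_GL2 flip: glued_mult)
      moreover have "glued h (r (\<rho>1 ?h' v)) = r v"
        using h by (simp add: gen[OF inv, symmetric] inverse R1.action_one flip: R1.action_mult)
      ultimately show ?case by simp
    next
      case (eng g h)
      then have gh: "g \<in> K1" "h \<in> K1" by (simp_all add: edge_stabiliser_def)
      have "r (\<rho>1 (g ** h) v) = glued (g ** h) (r v)"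
        using gh eng.IH by (simp add: R1.action_mult glued_mult edge_stabiliser_det)
      then show ?case by (simp add: GL2_def)
    qed
  qed
  have "equivariant_iso K0 smul0 \<rho>0 smul0 glued id"
    by (simp add: equivariant_iso_def glued_vertex R0.linear_id)
  moreover have "equivariant_iso K1 smul1 \<rho>1 smul0 glued r"
    using r by (simp add: equivariant_iso_def restrict)
  ultimately have "glues av w smul0 \<rho>0 smul1 \<rho>1 r smul0 glued"
    unfolding glues_def using smooth_representation_glued id_comp by blast
  then show ?thesis by blast
qed

text \<open>The two embeddings of the space of \<open>\<rho>0\<close> determine the isomorphism. It
  commutes with \<open>K0\<close> by construction and with Pi by compatibility with
  \<open>r\<close>, hence with all of G.\<close>

lemma glues_unique:
  assumes "glues av w smul0 \<rho>0 smul1 \<rho>1 r smul \<pi>" "glues av w smul0 \<rho>0 smul1 \<rho>1 r smul' \<pi>'"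
  shows "\<exists>\<phi>. equivariant_iso (carrier GL2) smul \<pi> smul' \<pi>' \<phi>"
proof -
  from assms(1) obtain i where rep: "smooth_representation smul (carrier GL2) \<pi>"
    and i0: "equivariant_iso K0 smul0 \<rho>0 smul \<pi> i"
    and i1: "equivariant_iso K1 smul1 \<rho>1 smul \<pi> (i \<circ> r)"
    by (auto simp: glues_def)
  from assms(2) obtain j where rep': "smooth_representation smul' (carrier GL2) \<pi>'"
    and j0: "equivariant_iso K0 smul0 \<rho>0 smul' \<pi>' j"
    and j1: "equivariant_iso K1 smul1 \<rho>1 smul' \<pi>' (j \<circ> r)"
    by (auto simp: glues_def)
  interpret R: smooth_representation smul "carrier GL2" \<pi> by fact
  interpret R': smooth_representation smul' "carrier GL2" \<pi>' by fact
  define \<phi> where "\<phi> = j \<circ> inv_into UNIV i"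
  have i: "Vector_Spaces.linear smul0 smul i" "bij i" and j: "Vector_Spaces.linear smul0 smul' j" "bij j"
    using i0 j0 by (auto simp: equivariant_iso_def)
  have \<phi>_i: "\<phi> (i v) = j v" for v
    using i(2) by (simp add: \<phi>_def bij_is_inj)
  have vertex: "\<phi> (\<pi> k u) = \<pi>' k (\<phi> u)" if k: "k \<in> K0" for k u
  proof -
    obtain v where "u = i v" using i(2) by (metis bij_pointE)
    moreover have "\<pi> k (i v) = i (\<rho>0 k v)" "\<pi>' k (j v) = j (\<rho>0 k v)"
      using i0 j0 k by (simp_all add: equivariant_iso_def)
    ultimately show ?thesis by (simp add: \<phi>_i)
  qed
  \<comment> \<open>Both edge embeddings factor through \<open>r\<close>, so \<open>\<phi>\<close>
    carries \<open>i \<circ> r\<close> to \<open>j \<circ> r\<close>.\<close>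
  have edge: "\<phi> (\<pi> Pi\<^sub>w u) = \<pi>' Pi\<^sub>w (\<phi> u)" for u
  proof -
    have "bij (i \<circ> r)" using i1 by (simp add: equivariant_iso_def)
    then obtain v where "u = (i \<circ> r) v" by (metis bij_pointE)
    moreover have "\<pi> Pi\<^sub>w ((i \<circ> r) v) = (i \<circ> r) (\<rho>1 Pi\<^sub>w v)"
      "\<pi>' Pi\<^sub>w ((j \<circ> r) v) = (j \<circ> r) (\<rho>1 Pi\<^sub>w v)"
      using i1 j1 Pi_in_edge_stabiliser unfolding equivariant_iso_def by metis+
    ultimately show ?thesis by (simp add: \<phi>_i)
  qed
  have "\<phi> (\<pi> g u) = \<pi>' g (\<phi> u)" if "det g \<noteq> 0" for g u
    using that
  proof (induction g arbitrary: u rule: GL2_induct)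
    case (Pi k h)
    then have "k \<in> carrier GL2" "h \<in> carrier GL2" "Pi\<^sub>w ** h \<in> carrier GL2" "Pi\<^sub>w \<in> carrier GL2"
      by (simp_all add: carrier_GL2 vertex_stabiliser_det det_mul)
    then show ?case
      using Pi by (simp add: R.action_mult R'.action_mult vertex edge)
  qed (rule vertex)
  moreover have "Vector_Spaces.linear smul smul' \<phi>" "bij \<phi>"
    unfolding \<phi>_def using i j by (blast intro: Vector_Spaces.linear_compose linear_inv bij_comp bij_imp_bij_inv)+
  ultimately show ?thesis by (auto simp: equivariant_iso_def carrier_GL2)
qed

end

theorem corollary5p18:
  fixes av :: "'f::{field, complete_space} \<Rightarrow> real"
    and w :: 'f
    and smul0 :: "'p::prime_card fp_closure \<Rightarrow> 'v0::ab_group_add \<Rightarrow> 'v0"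
    and \<rho>0 :: "'f ^ 2 ^ 2 \<Rightarrow> 'v0 \<Rightarrow> 'v0"
    and smul1 :: "'p fp_closure \<Rightarrow> 'v1::ab_group_add \<Rightarrow> 'v1"
    and \<rho>1 :: "'f ^ 2 ^ 2 \<Rightarrow> 'v1 \<Rightarrow> 'v1"
    and r :: "'v1 \<Rightarrow> 'v0"
  assumes "nonarch_local_field av"
    and "residue_char av = CARD('p)"
    and "uniformiser av w"
    and "smooth_representation smul0 (vertex_stabiliser av) \<rho>0"
    and "smooth_representation smul1 (edge_stabiliser av w) \<rho>1"
    and "equivariant_iso (scalar_multiples (Iwahori av)) smul1 \<rho>1 smul0 \<rho>0 r"
  shows
    "(\<exists>(smul :: 'p fp_closure \<Rightarrow> 'v0 \<Rightarrow> 'v0) \<pi>. glues av w smul0 \<rho>0 smul1 \<rho>1 r smul \<pi>) \<and>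
     (\<forall>(smul :: 'p fp_closure \<Rightarrow> 'u::ab_group_add \<Rightarrow> 'u) \<pi>
       (smul' :: 'p fp_closure \<Rightarrow> 'u'::ab_group_add \<Rightarrow> 'u') \<pi>'.
        glues av w smul0 \<rho>0 smul1 \<rho>1 r smul \<pi> \<longrightarrow>
        glues av w smul0 \<rho>0 smul1 \<rho>1 r smul' \<pi>' \<longrightarrow>
        (\<exists>\<phi>. equivariant_iso (carrier GL2) smul \<pi> smul' \<pi>' \<phi>))"
proof -
  interpret uniformised_local_field av w
    using assms(1,3) by (simp add: uniformised_local_field_def uniformised_local_field_axioms_def)
  show ?thesis
    using ex_glues[OF assms(4-6)] glues_unique by blast
qed

end
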